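(* Every finite monoid is surjunctive.
   Context: Let $M$ be a monoid and $A$ a set. The set $A^M$ of all maps $x\colon M\to A$ carries the shift action of $M$ given by $(mx)(m') := x(m'm)$ for $m,m'\in M$, and the prodiscrete uniform structure, for which a base of entourages is given by the sets $W_F := \{(x,y)\in A^M\times A^M : x|_F = y|_F\}$, $F$ running over all finite subsets of $M$. A cellular automaton over $M$ with alphabet $A$ is a map $\tau\colon A^M\to A^M$ that is $M$-equivariant ($\tau(mx)=m\tau(x)$ for all $m\in M$, $x\in A^M$) and uniformly continuous. The monoid $M$ is called surjunctive if, for every finite set $A$, every injective cellular automaton $\tau\colon A^M\to A^M$ is surjective. *)

theory Defs
  imports Complex_Main "HOL-Algebra.Group"
begin

text \<open>
  The set of all maps from the monoid to the alphabet is the extensional function space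
  \<open>carrier M \<rightarrow>\<^sub>E A\<close>: its elements are \<open>undefined\<close> outside the carrier, so that two
  configurations are equal iff they agree on the carrier.
\<close>

definition configs :: "('a, 'm) monoid_scheme \<Rightarrow> 'b set \<Rightarrow> ('a \<Rightarrow> 'b) set"
  where "configs M A = carrier M \<rightarrow>\<^sub>E A"

definition shift :: "('a, 'm) monoid_scheme \<Rightarrow> 'a \<Rightarrow> ('a \<Rightarrow> 'b) \<Rightarrow> 'a \<Rightarrow> 'b"
  where "shift M m x = (\<lambda>m'\<in>carrier M. x (m' \<otimes>\<^bsub>M\<^esub> m))"

definition agree_on ::
    "('a, 'm) monoid_scheme \<Rightarrow> 'b set \<Rightarrow> 'a set \<Rightarrow> (('a \<Rightarrow> 'b) \<times> ('a \<Rightarrow> 'b)) set"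
  where "agree_on M A F =
    {(x, y) \<in> configs M A \<times> configs M A. \<forall>m\<in>F. x m = y m}"

text \<open>
  As in the class \<^class>\<open>uniform_space\<close>, a uniform structure is represented by the filter of
  its entourages. The class itself is not applicable, because the configurations form a set
  rather than a type and the alphabet carries the discrete uniformity.
\<close>

definition prodiscrete_uniformity ::
    "('a, 'm) monoid_scheme \<Rightarrow> 'b set \<Rightarrow> (('a \<Rightarrow> 'b) \<times> ('a \<Rightarrow> 'b)) filter"
  where "prodiscrete_uniformity M A =
    (INF F\<in>{F. finite F \<and> F \<subseteq> carrier M}. principal (agree_on M A F))"

text \<open>The sets \<^const>\<open>agree_on\<close> are a base of the filter, not merely a subbase.\<close>

lemma eventually_prodiscrete_uniformity:
  "eventually P (prodiscrete_uniformity M A) \<longleftrightarrow>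
    (\<exists>F. finite F \<and> F \<subseteq> carrier M \<and> (\<forall>p\<in>agree_on M A F. P p))"
  unfolding prodiscrete_uniformity_def
proof (subst eventually_INF_base)
  show "{F. finite F \<and> F \<subseteq> carrier M} \<noteq> {}" by blast
next
  fix F G
  assume "F \<in> {F. finite F \<and> F \<subseteq> carrier M}" "G \<in> {F. finite F \<and> F \<subseteq> carrier M}"
  then show "\<exists>H\<in>{F. finite F \<and> F \<subseteq> carrier M}.
      principal (agree_on M A H) \<le> inf (principal (agree_on M A F)) (principal (agree_on M A G))"
    by (intro bexI[of _ "F \<union> G"]) (auto simp: agree_on_def)
qed (auto simp: eventually_principal)

definition cellular_automaton ::
    "('a, 'm) monoid_scheme \<Rightarrow> 'b set \<Rightarrow> (('a \<Rightarrow> 'b) \<Rightarrow> 'a \<Rightarrow> 'b) \<Rightarrow> bool"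
  where "cellular_automaton M A \<tau> \<longleftrightarrow>
    \<tau> \<in> configs M A \<rightarrow> configs M A \<and>
    (\<forall>m\<in>carrier M. \<forall>x\<in>configs M A. \<tau> (shift M m x) = shift M m (\<tau> x)) \<and>
    filterlim (\<lambda>(x, y). (\<tau> x, \<tau> y)) (prodiscrete_uniformity M A) (prodiscrete_uniformity M A)"

text \<open>
  A definition cannot quantify over types, so the type from which the finite alphabets are
  taken is a parameter. Surjunctivity is the statement \<open>surjunctive TYPE('b) M\<close> for all
  types \<open>'b\<close>, that is, with \<open>'b\<close> a free type variable.
\<close>

definition surjunctive :: "'b itself \<Rightarrow> ('a, 'm) monoid_scheme \<Rightarrow> bool"
  where "surjunctive _ M \<longleftrightarrow>
    (\<forall>(A :: 'b set) \<tau>. finite A \<longrightarrow> cellular_automaton M A \<tau> \<longrightarrow> inj_on \<tau> (configs M A) \<longrightarrow>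
      \<tau> ` configs M A = configs M A)"

end

theory Submission
  imports Defs
begin

text \<open>A finite monoid and a finite alphabet admit only finitely many configurations, so the
  pigeonhole principle applies: an injective map of a finite set into itself is onto
  (\<open>endo_inj_surj\<close>).\<close>

theorem proposition5p3:
  fixes M :: "('a, 'm) monoid_scheme"
  assumes "monoid M"
    and "finite (carrier M)"
  shows "surjunctive TYPE('b) M"
  unfolding surjunctive_def
proof (intro allI impI)
  fix A :: "'b set" and \<tau> :: "('a \<Rightarrow> 'b) \<Rightarrow> 'a \<Rightarrow> 'b"
  assume "finite A" and "cellular_automaton M A \<tau>" and inj: "inj_on \<tau> (configs M A)"
  \<comment> \<open>Extensionality matters here: configurations are fixed to
    \<open>undefined\<close> outside the carrier, so only their values at the finitely many monoid
    elements count.\<close>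
  have "finite (configs M A)"
    unfolding configs_def using assms(2) \<open>finite A\<close> by (simp add: finite_PiE)
  moreover have "\<tau> ` configs M A \<subseteq> configs M A"
    using \<open>cellular_automaton M A \<tau>\<close> by (auto simp: cellular_automaton_def)
  ultimately show "\<tau> ` configs M A = configs M A"
    using inj by (rule endo_inj_surj)
qed

end
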